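(* Let $A$ be an $n\times n$ real matrix that is $TP_k$ for some integer $k$ with $1\leq k\leq n-2$. If the Dodgson condensation matrix $D_k(A)$ is $TP_2$, then $A$ is $TP_{k+2}$.
   Context: A real $m\times n$ matrix is called $TP_r$, where $1\leq r\leq\min\{m,n\}$, if all of its minors (determinants of square submatrices, with rows and columns kept in increasing order) of every order $1,2,\ldots,r$ are positive. Dodgson condensation matrices: for $A=[a_{i,j}]$ an $n\times n$ real matrix put $D_0(A)=A$, i.e. $M^{(0)}_{i,j}=a_{i,j}$. Let $D_1(A)=[M^{(1)}_{i,j}]$ be the $(n-1)\times(n-1)$ matrix with $M^{(1)}_{i,j}=a_{i,j}a_{i+1,j+1}-a_{i,j+1}a_{i+1,j}$. For $2\leq k\leq n-1$, let $D_k(A)=[M^{(k)}_{i,j}]$ be the $(n-k)\times(n-k)$ matrix with $$M^{(k)}_{i,j}=\frac{M^{(k-1)}_{i,j}M^{(k-1)}_{i+1,j+1}-M^{(k-1)}_{i,j+1}M^{(k-1)}_{i+1,j}}{M^{(k-2)}_{i+1,j+1}},\qquad i,j=1,\ldots,n-k.$$ Equivalently (whenever the denominators are nonzero), $M^{(k)}_{i,j}$ is the contiguous minor of $A$ of order $k+1$ in rows $i,\ldots,i+k$ and columns $j,\ldots,j+k$. *)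

theory Defs
  imports Complex_Main "Jordan_Normal_Form.Determinant" "Jordan_Normal_Form.DL_Submatrix"
begin

text \<open>
  Matrices are indexed from 0. The selection made by \<^const>\<open>submatrix\<close> keeps the rows and columns
  in increasing order, so the determinants below are the minors of \<open>A\<close>.
\<close>

definition TP :: "nat \<Rightarrow> real mat \<Rightarrow> bool" where
  "TP r A \<longleftrightarrow> 1 \<le> r \<and> r \<le> min (dim_row A) (dim_col A) \<and>
     (\<forall>I J. I \<subseteq> {0..<dim_row A} \<longrightarrow> J \<subseteq> {0..<dim_col A} \<longrightarrow>
        card I = card J \<longrightarrow> 1 \<le> card I \<longrightarrow> card I \<le> r \<longrightarrow> det (submatrix A I J) > 0)"

text \<open>
  The matrix \<open>dodgson k A\<close> is meaningful for \<open>k \<le> n - 1\<close> where \<open>A\<close> is \<open>n \<times> n\<close>, and when no entry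
  used as a denominator vanishes (otherwise the convention \<open>x / 0 = 0\<close> applies). If \<open>A\<close> is \<open>TP k\<close>,
  every denominator occurring in \<open>dodgson k A\<close> is a minor of order at most \<open>k - 1\<close>, hence positive.
\<close>

fun dodgson :: "nat \<Rightarrow> real mat \<Rightarrow> real mat" where
  "dodgson 0 A = A"
| "dodgson (Suc 0) A =
     mat (dim_row A - 1) (dim_col A - 1)
       (\<lambda>(i, j). A $$ (i, j) * A $$ (i + 1, j + 1) - A $$ (i, j + 1) * A $$ (i + 1, j))"
| "dodgson (Suc (Suc k)) A =
     (let M = dodgson (Suc k) A; N = dodgson k A in
      mat (dim_row A - (k + 2)) (dim_col A - (k + 2))
       (\<lambda>(i, j). (M $$ (i, j) * M $$ (i + 1, j + 1) - M $$ (i, j + 1) * M $$ (i + 1, j))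
                  / N $$ (i + 1, j + 1)))"

end

theory Submission
  imports Defs
begin

text \<open>
  A three-term Pluecker relation between determinants of row lists does all the work. With a unit
  vector as one of the rows it is the Desnanot--Jacobi identity, which shows that the entries of
  \<open>D\<^sub>k(A)\<close> are the contiguous minors of order \<open>k + 1\<close> and that its contiguous \<open>2 \<times> 2\<close> minors are the
  contiguous minors of order \<open>k + 2\<close> multiplied by positive minors of order \<open>k\<close>. It also yields
  Fekete's criterion: if the minors of order \<open>p\<close> and the contiguous minors of order \<open>p + 1\<close> are
  positive, then so are all minors of order \<open>p + 1\<close>. Applying this with \<open>p = k\<close> and
  \<open>p = k + 1\<close> gives the theorem.
\<close>

section \<open>Determinants of lists of rows\<close>

text \<open>
  Only the first \<open>length xs\<close> coordinates of the rows enter, so dropping a row also drops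
  the last column.
\<close>

definition rows_det :: "(nat \<Rightarrow> real) list \<Rightarrow> real" where
  "rows_det xs = det (mat (length xs) (length xs) (\<lambda>(i, j). (xs ! i) j))"

lemma rows_det_Nil [simp]: "rows_det [] = 1"
  by (simp add: rows_det_def det_def)

lemma rows_det_cong:
  assumes "length xs = length ys"
    and "\<And>i j. i < length xs \<Longrightarrow> j < length xs \<Longrightarrow> (xs ! i) j = (ys ! i) j"
  shows "rows_det xs = rows_det ys"
proof -
  have "mat (length xs) (length xs) (\<lambda>(i, j). (xs ! i) j) =
      mat (length ys) (length ys) (\<lambda>(i, j). (ys ! i) j)"
    using assms by (intro eq_matI) auto
  then show ?thesis
    by (simp add: rows_det_def)
qed

lemma rows_det_Cons:
  "rows_det (x # xs) = (\<Sum>j\<le>length xs. x j * ((-1) ^ j *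
     rows_det (map (\<lambda>y l. y (if l < j then l else Suc l)) xs)))"
proof -
  let ?n = "Suc (length xs)"
  let ?M = "mat ?n ?n (\<lambda>(i, j). ((x # xs) ! i) j)"
  have del: "mat_delete ?M 0 j = mat (length xs) (length xs)
      (\<lambda>(i, l). (map (\<lambda>y l. y (if l < j then l else Suc l)) xs ! i) l)" if "j < ?n" for j
    using that by (intro eq_matI) (auto simp: mat_delete_def)
  have "rows_det (x # xs) = det ?M"
    by (simp add: rows_det_def)
  also have "\<dots> = (\<Sum>j<?n. ?M $$ (0, j) * cofactor ?M 0 j)"
    by (rule laplace_expansion_row) auto
  also have "\<dots> = (\<Sum>j<?n. x j * ((-1) ^ j *
     rows_det (map (\<lambda>y l. y (if l < j then l else Suc l)) xs)))"
    by (intro sum.cong) (auto simp: cofactor_def del rows_det_def)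
  finally show ?thesis
    by (simp add: lessThan_Suc_atMost)
qed

text \<open>Only the term \<open>j = 0\<close> of the expansion along the first row survives, so
  prepending this unit vector deletes the first column from the other rows.\<close>

lemma rows_det_unit_Cons:
  "rows_det ((\<lambda>j. if j = 0 then 1 else 0) # xs) = rows_det (map (\<lambda>y l. y (Suc l)) xs)"
proof -
  have "rows_det ((\<lambda>j. if j = 0 then 1 else 0) # xs) =
    (\<Sum>j\<in>{0::nat}. rows_det (map (\<lambda>y l. y (Suc l)) xs))"
    unfolding rows_det_Cons by (intro sum.mono_neutral_cong_right) auto
  then show ?thesis by simp
qed

lemma rows_det_repeat:
  assumes "x \<in> set xs"
  shows "rows_det (x # xs) = 0"
proof -
  obtain i where i: "i < length xs" "xs ! i = x"
    using assms by (auto simp: in_set_conv_nth)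
  show ?thesis
    unfolding rows_det_def
    by (rule det_identical_rows[of _ _ 0 "Suc i"]) (use i in auto)
qed

lemma rows_det_swap:
  "rows_det (us @ x # y # ys) = - rows_det (us @ y # x # ys)"
proof -
  let ?n = "length us + (2 + length ys)" and ?k = "length us"
  let ?M = "\<lambda>xs. mat ?n ?n (\<lambda>(i, j). (xs ! i) j) :: real mat"
  have "?M (us @ y # x # ys) = swaprows ?k (Suc ?k) (?M (us @ x # y # ys))"
    by (intro eq_matI) (auto simp: nth_append nth_Cons split: nat.splits)
  then have "det (?M (us @ y # x # ys)) = - det (?M (us @ x # y # ys))"
    using det_swaprows[of ?k ?n "Suc ?k" "?M (us @ x # y # ys)"] by simp
  then show ?thesis by (simp add: rows_det_def)
qed

lemma rows_det_move:
  "rows_det (us @ x # xs @ ys) = (-1) ^ length xs * rows_det (us @ xs @ x # ys)"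
proof (induction xs arbitrary: us)
  case (Cons y xs)
  have "rows_det (us @ x # (y # xs) @ ys) = - rows_det ((us @ [y]) @ x # xs @ ys)"
    using rows_det_swap[of us x y "xs @ ys"] by simp
  also have "\<dots> = (-1) ^ length (y # xs) * rows_det (us @ (y # xs) @ x # ys)"
    unfolding Cons.IH by simp
  finally show ?case .
qed simp

section \<open>Exchange and Pluecker relations\<close>

text \<open>Cramer's rule: expand a determinant whose first column repeats the \<open>j\<close>-th coordinate.\<close>

lemma rows_det_cramer:
  assumes len: "length xs = Suc p" and j: "j < p"
  shows "(\<Sum>i\<le>p. (-1) ^ i * (xs ! i) j * rows_det (take i xs @ drop (Suc i) xs)) = 0"
proof -
  let ?M = "mat (Suc p) (Suc p)
    (\<lambda>(i, l). if l = 0 then (xs ! i) j else (xs ! i) (l - 1)) :: real mat"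
  have del: "mat_delete ?M i 0 =
      mat p p (\<lambda>(r, l). ((take i xs @ drop (Suc i) xs) ! r) l)" if "i \<le> p" for i
    using that len by (intro eq_matI) (auto simp: mat_delete_def nth_append min_def)
  have "0 = det ?M"
    by (rule det_identical_columns[of _ "Suc p" 0 "Suc j", symmetric])
      (use j in auto)
  also have "\<dots> = (\<Sum>i<Suc p. ?M $$ (i, 0) * cofactor ?M i 0)"
    by (rule laplace_expansion_column) auto
  also have "\<dots> = (\<Sum>i<Suc p. (-1) ^ i * (xs ! i) j * rows_det (take i xs @ drop (Suc i) xs))"
    using len by (intro sum.cong) (auto simp: cofactor_def del rows_det_def min_def)
  finally show ?thesis
    by (simp add: lessThan_Suc_atMost)
qed

text \<open>Expanding \<open>rows_det (xs ! i # ys)\<close> along its first row gives a combination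
  of the coordinates \<open>j \<le> length ys\<close> of \<open>xs ! i\<close>, with coefficients
  independent of \<open>i\<close>. As \<open>length ys < p\<close>, Cramer's rule makes the sum over
  \<open>i\<close> vanish for each \<open>j\<close>.\<close>

lemma rows_det_exchange:
  assumes len: "length xs = Suc p" and ys: "length ys < p"
  shows "(\<Sum>i\<le>p. (-1) ^ i * rows_det (xs ! i # ys) * rows_det (take i xs @ drop (Suc i) xs)) = 0"
proof -
  let ?c = "\<lambda>j. (-1) ^ j * rows_det (map (\<lambda>y l. y (if l < j then l else Suc l)) ys)"
  let ?d = "\<lambda>i. rows_det (take i xs @ drop (Suc i) xs)"
  have "(\<Sum>i\<le>p. (-1) ^ i * rows_det (xs ! i # ys) * ?d i) =
      (\<Sum>i\<le>p. \<Sum>j\<le>length ys. ?c j * ((-1) ^ i * (xs ! i) j * ?d i))"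
    by (intro sum.cong) (auto simp: rows_det_Cons sum_distrib_left sum_distrib_right mult_ac)
  also have "\<dots> = (\<Sum>j\<le>length ys. ?c j * (\<Sum>i\<le>p. (-1) ^ i * (xs ! i) j * ?d i))"
    unfolding sum_distrib_left by (rule sum.swap)
  also have "\<dots> = 0"
    using ys by (intro sum.neutral ballI) (simp add: rows_det_cramer[OF len])
  finally show ?thesis .
qed

text \<open>
  A three-term Pluecker relation in which the shorter lists see one coordinate less, so that all
  signs disappear when the rows are kept in order.
\<close>

lemma rows_det_three_term:
  "rows_det (a # S @ T @ [c]) * rows_det (S @ b # T) =
   rows_det (S @ b # T @ [c]) * rows_det (a # S @ T) +
   rows_det (a # S @ b # T) * rows_det (S @ T @ [c])"
proof -
  define xs where "xs = a # S @ b # T @ [c]"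
  define s t where "s = length S" and "t = length T"
  let ?p = "s + t + 2"
  let ?f = "\<lambda>i. (-1) ^ i * rows_det (xs ! i # S @ T) * rows_det (take i xs @ drop (Suc i) xs)"
  \<comment> \<open>A row of \<open>S\<close> or \<open>T\<close> put in front of
    \<open>S @ T\<close> occurs twice, so only the terms of \<open>a\<close>, \<open>b\<close> and
    \<open>c\<close> remain.\<close>
  have zero: "?f i = 0" if "i \<le> ?p" "i \<notin> {0, Suc s, ?p}" for i
  proof -
    have "xs ! i \<in> set (S @ T)"
      using that by (auto simp: xs_def s_def t_def nth_append nth_Cons split: nat.splits)
    then show ?thesis by (simp add: rows_det_repeat)
  qed
  have "0 = (\<Sum>i\<le>?p. ?f i)"
    by (rule rows_det_exchange[symmetric]) (auto simp: xs_def s_def t_def)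
  also have "\<dots> = (\<Sum>i\<in>{0, Suc s, ?p}. ?f i)"
    using zero by (intro sum.mono_neutral_right) auto
  also have "\<dots> = ?f 0 + ?f (Suc s) + ?f ?p"
    by simp
  also have "?f 0 = rows_det (a # S @ T) * rows_det (S @ b # T @ [c])"
    by (simp add: xs_def)
  \<comment> \<open>Moving \<open>b\<close> behind \<open>S\<close> costs \<open>(-1) ^ s\<close>
    against the sign \<open>(-1) ^ Suc s\<close>, which leaves a minus. For \<open>c\<close>, moved
    behind \<open>S @ T\<close>, the two signs cancel.\<close>
  also have "?f (Suc s) = - (rows_det (S @ b # T) * rows_det (a # S @ T @ [c]))"
    using rows_det_move[of "[]" b S T] by (simp add: xs_def s_def)
  also have "?f ?p = rows_det (S @ T @ [c]) * rows_det (a # S @ b # T)"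
    using rows_det_move[of "[]" c "S @ T" "[]"]
    by (simp add: xs_def s_def t_def nth_append)
  finally show ?thesis
    by (simp add: algebra_simps)
qed

text \<open>This is the three-term relation with \<open>a\<close> the first unit vector,
  \<open>S\<close> empty, \<open>b = x\<close> and \<open>c = y\<close>; the unit vector is then
  removed together with the first column.\<close>

lemma rows_det_desnanot_jacobi:
  "rows_det (x # S @ [y]) * rows_det (map (\<lambda>z l. z (Suc l)) S) =
   rows_det (map (\<lambda>z l. z (Suc l)) (S @ [y])) * rows_det (x # S) -
   rows_det (map (\<lambda>z l. z (Suc l)) (x # S)) * rows_det (S @ [y])"
  using rows_det_three_term[of "\<lambda>j. if j = 0 then 1 else 0" "[]" S y x]
  unfolding rows_det_unit_Cons append_Nil by linarith

section \<open>Fekete's criterion\<close>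

text \<open>
  Induction on the spread \<open>last rs - hd rs\<close>: if a row \<open>b\<close> is missing in between, the three-term
  relation replaces the first or the last row by \<open>b\<close>.
\<close>

lemma rows_det_pos_of_contiguous:
  fixes R :: "nat \<Rightarrow> nat \<Rightarrow> real"
  assumes p: "1 \<le> p"
    and lower: "\<And>rs. sorted_wrt (<) rs \<Longrightarrow> set rs \<subseteq> {..<n} \<Longrightarrow> length rs = p \<Longrightarrow>
      rows_det (map R rs) > 0"
    and contiguous: "\<And>i. i + Suc p \<le> n \<Longrightarrow> rows_det (map R [i..<i + Suc p]) > 0"
  shows "sorted_wrt (<) rs \<Longrightarrow> set rs \<subseteq> {..<n} \<Longrightarrow> length rs = Suc p \<Longrightarrow>
      rows_det (map R rs) > 0"
proof (induction "last rs - hd rs" arbitrary: rs rule: less_induct)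
  case less
  obtain a rs' where rs': "rs = a # rs'"
    using less.prems(3) by (cases rs) auto
  with less.prems(3) p have "rs' \<noteq> []"
    by auto
  then obtain U c where U: "rs' = U @ [c]"
    by (metis append_butlast_last_id)
  have rs: "rs = a # U @ [c]"
    using rs' U by simp
  have bounds: "a < c" "\<And>u. u \<in> set U \<Longrightarrow> a < u \<and> u < c" "sorted_wrt (<) U"
    and lt: "a < n" "c < n" "set U \<subseteq> {..<n}" and len: "Suc (length U) = p"
    using less.prems by (auto simp: rs sorted_wrt_append)
  show ?case
  proof (cases "{a<..<c} \<subseteq> set U")
    case True
    then have "set U = {a<..<c}"
      using bounds(2) by auto
    then have "set rs = set [a..<Suc c]"
      using bounds(1) by (auto simp: rs)
    then have eq: "rs = [a..<Suc c]"
      using less.prems(1)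
      by (intro sorted_distinct_set_unique) (auto simp: strict_sorted_iff simp del: upt_Suc)
    then have "length rs = Suc c - a"
      by (simp del: upt_Suc)
    then have "Suc c = a + Suc p"
      using less.prems(3) bounds(1) by simp
    then show ?thesis
      using contiguous[of a] lt(2) eq by simp
  next
    case False
    then obtain b where b: "a < b" "b < c" "b \<notin> set U"
      by (meson greaterThanLessThan_iff subsetI)
    define S T where "S = filter (\<lambda>u. u < b) U" and "T = filter (\<lambda>u. b < u) U"
    have ST: "U = S @ T"
    proof (rule sorted_distinct_set_unique)
      have "sorted_wrt (<) (S @ T)"
        using bounds(3) by (auto simp: S_def T_def sorted_wrt_append sorted_wrt_filter)
      then show "sorted (S @ T)" "distinct (S @ T)"
        by (auto simp: strict_sorted_iff)
      show "set U = set (S @ T)"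
        using b(3) by (auto simp: S_def T_def) (metis nat_neq_iff)
    qed (use bounds(3) in \<open>auto simp: strict_sorted_iff\<close>)
    have lbs: "sorted_wrt (<) S" "sorted_wrt (<) T" "set S \<subseteq> {a<..<b}" "set T \<subseteq> {b<..<c}"
      using bounds by (auto simp: S_def T_def sorted_wrt_filter)
    have lenST: "length S + length T + 1 = p"
      using len by (simp add: ST)
    have ord: "sorted_wrt (<) (a # S @ T)" "sorted_wrt (<) (S @ b # T)"
      "sorted_wrt (<) (S @ T @ [c])" "sorted_wrt (<) (a # S @ b # T)"
      "sorted_wrt (<) (S @ b # T @ [c])"
      using lbs b(1,2) bounds(1) by (fastforce simp: sorted_wrt_append)+
    \<comment> \<open>These are the factors with \<open>p\<close> rows in the three-term relation,
      covered by \<open>lower\<close>. The two factors with \<open>p + 1\<close> rows on its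
      right-hand side have smaller spread and fall to the induction hypothesis.\<close>
    have pos: "rows_det (map R (a # S @ T)) > 0" "rows_det (map R (S @ b # T)) > 0"
      "rows_det (map R (S @ T @ [c])) > 0"
      using lt b lenST by (intro lower ord; auto simp: ST)+
    have "rows_det (map R (a # S @ b # T)) > 0"
    proof (rule less.hyps)
      have "last (a # S @ b # T) < c"
        using lbs b by (cases T rule: rev_cases) auto
      moreover have "a \<le> last (a # S @ b # T)"
        using lbs b by (cases T rule: rev_cases) auto
      ultimately show "last (a # S @ b # T) - hd (a # S @ b # T) < last rs - hd rs"
        by (simp only: rs list.sel(1) last.simps last_snoc last_append) (simp add: diff_less_mono)
    qed (use ord lt b lenST in \<open>auto simp: ST\<close>)
    moreover have "rows_det (map R (S @ b # T @ [c])) > 0"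
    proof (rule less.hyps)
      have "a < hd (S @ b # T @ [c])"
        using lbs b by (cases S) auto
      then show "last (S @ b # T @ [c]) - hd (S @ b # T @ [c]) < last rs - hd rs"
        using bounds(1) by (simp add: rs)
    qed (use ord lt b lenST in \<open>auto simp: ST\<close>)
    ultimately have "0 < rows_det (map R rs) * rows_det (map R (S @ b # T))"
      using rows_det_three_term[of "R a" "map R S" "map R T" "R c" "R b"] pos
      by (simp add: rs ST add_pos_pos)
    then show ?thesis
      using pos(2) by (simp add: zero_less_mult_iff)
  qed
qed

text \<open>The column selection is built into the row functions, so the results on row lists apply
  for any fixed \<open>cs\<close>. Only the first \<open>length rs\<close> entries of
  \<open>cs\<close> are read.\<close>

definition minor :: "(nat \<Rightarrow> nat \<Rightarrow> real) \<Rightarrow> nat list \<Rightarrow> nat list \<Rightarrow> real" where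
  "minor a rs cs = rows_det (map (\<lambda>r j. a r (cs ! j)) rs)"

lemma minor_transpose:
  assumes "length rs = length cs"
  shows "minor (\<lambda>i j. a j i) cs rs = minor a rs cs"
proof -
  let ?n = "length cs"
  let ?M = "mat ?n ?n (\<lambda>(i, j). a (rs ! i) (cs ! j))"
  have "minor a rs cs = det ?M"
    unfolding minor_def rows_det_def using assms
    by (intro arg_cong[where f = det] eq_matI) auto
  also have "\<dots> = det (transpose_mat ?M)"
    by (rule det_transpose[symmetric]) auto
  also have "\<dots> = minor (\<lambda>i j. a j i) cs rs"
    unfolding minor_def rows_det_def using assms
    by (intro arg_cong[where f = det] eq_matI) auto
  finally show ?thesis by simp
qed

text \<open>Strictly increasing lists stand for index sets. A single order \<open>p\<close> is fixed
  because Fekete's criterion raises the order by one at a time.\<close>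

definition minors_pos :: "nat \<Rightarrow> nat \<Rightarrow> (nat \<Rightarrow> nat \<Rightarrow> real) \<Rightarrow> bool" where
  "minors_pos n p a \<longleftrightarrow> (\<forall>rs cs. sorted_wrt (<) rs \<longrightarrow> sorted_wrt (<) cs \<longrightarrow>
     set rs \<subseteq> {..<n} \<longrightarrow> set cs \<subseteq> {..<n} \<longrightarrow> length rs = p \<longrightarrow> length cs = p \<longrightarrow> minor a rs cs > 0)"

lemma minors_posD:
  assumes "minors_pos n p a" "sorted_wrt (<) rs" "sorted_wrt (<) cs" "set rs \<subseteq> {..<n}"
    "set cs \<subseteq> {..<n}" "length rs = p" "length cs = p"
  shows "minor a rs cs > 0"
  using assms by (simp add: minors_pos_def)

text \<open>With the columns fixed, this is the criterion for row lists. Determinants of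
  \<open>p\<close> rows read only the first \<open>p\<close> columns, so they are minors with
  columns \<open>take p cs\<close>.\<close>

lemma minor_pos_of_contiguous_rows:
  assumes p: "1 \<le> p" and pos: "minors_pos n p a"
    and cs: "sorted_wrt (<) cs" "set cs \<subseteq> {..<n}" "length cs = Suc p"
    and contiguous: "\<And>i. i + Suc p \<le> n \<Longrightarrow> minor a [i..<i + Suc p] cs > 0"
    and rs: "sorted_wrt (<) rs" "set rs \<subseteq> {..<n}" "length rs = Suc p"
  shows "minor a rs cs > 0"
  unfolding minor_def
proof (rule rows_det_pos_of_contiguous[OF p _ _ rs])
  fix rs assume rs: "sorted_wrt (<) rs" "set rs \<subseteq> {..<n}" "length rs = p"
  have "minor a rs (take p cs) > 0"
    using cs rs by (intro minors_posD[OF pos])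
      (auto simp: sorted_wrt_take dest: in_set_takeD)
  also have "minor a rs (take p cs) = rows_det (map (\<lambda>r j. a r (cs ! j)) rs)"
    unfolding minor_def using rs by (intro rows_det_cong) auto
  finally show "rows_det (map (\<lambda>r j. a r (cs ! j)) rs) > 0" .
qed (use contiguous in \<open>simp add: minor_def\<close>)

text \<open>The row criterion is used twice: first for contiguous columns, to reach arbitrary rows,
  and then on the transpose, to reach arbitrary columns.\<close>

lemma fekete:
  assumes p: "1 \<le> p" and pos: "minors_pos n p a"
    and contiguous: "\<And>i j. i + Suc p \<le> n \<Longrightarrow> j + Suc p \<le> n \<Longrightarrow>
      minor a [i..<i + Suc p] [j..<j + Suc p] > 0"
  shows "minors_pos n (Suc p) a"
proof -
  have pos': "minors_pos n p (\<lambda>i j. a j i)"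
    unfolding minors_pos_def
  proof (intro allI impI)
    fix rs cs
    assume "sorted_wrt (<) rs" "sorted_wrt (<) cs" "set rs \<subseteq> {..<n}" "set cs \<subseteq> {..<n}"
      "length rs = p" "length cs = p"
    then show "minor (\<lambda>i j. a j i) rs cs > 0"
      using minor_transpose[of cs rs a] minors_posD[OF pos, of cs rs] by simp
  qed
  have rows: "minor a rs [j..<j + Suc p] > 0"
    if "sorted_wrt (<) rs" "set rs \<subseteq> {..<n}" "length rs = Suc p" "j + Suc p \<le> n" for rs j
  proof (rule minor_pos_of_contiguous_rows[OF p pos _ _ _ _ that(1-3)])
    show "sorted_wrt (<) [j..<j + Suc p]"
      by (simp add: strict_sorted_iff del: upt_Suc)
    show "set [j..<j + Suc p] \<subseteq> {..<n}" "length [j..<j + Suc p] = Suc p"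
      using that(4) by (auto simp del: upt_Suc)
    show "minor a [i..<i + Suc p] [j..<j + Suc p] > 0" if "i + Suc p \<le> n" for i
      using contiguous that \<open>j + Suc p \<le> n\<close> by blast
  qed
  show ?thesis
    unfolding minors_pos_def
  proof (intro allI impI)
    fix rs cs
    assume rs: "sorted_wrt (<) rs" "set rs \<subseteq> {..<n}" "length rs = Suc p"
      and cs: "sorted_wrt (<) cs" "set cs \<subseteq> {..<n}" "length cs = Suc p"
    have "minor (\<lambda>i j. a j i) [j..<j + Suc p] rs > 0" if "j + Suc p \<le> n" for j
      using rows[OF rs that] minor_transpose[of rs "[j..<j + Suc p]" a] rs(3) by simp
    then have "minor (\<lambda>i j. a j i) cs rs > 0"
      by (rule minor_pos_of_contiguous_rows[OF p pos' rs _ cs])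
    then show "minor a rs cs > 0"
      using minor_transpose[of rs cs a] rs cs by simp
  qed
qed

section \<open>Submatrices and index lists\<close>

lemma pick_eq_nth_sorted_list_of_set:
  assumes "finite I" "i < card I"
  shows "pick I i = sorted_list_of_set I ! i"
proof -
  have "map (pick I) [0..<card I] = sorted_list_of_set I"
  proof (rule sorted_distinct_set_unique)
    have "sorted_wrt (<) (map (pick I) [0..<card I])"
      using pick_mono_le by (auto simp: sorted_wrt_iff_nth_less)
    then show "sorted (map (pick I) [0..<card I])" "distinct (map (pick I) [0..<card I])"
      by (auto simp: strict_sorted_iff)
    \<comment> \<open>An injective map from \<open>card I\<close> indices into the finite set
      \<open>I\<close> is onto.\<close>
    have "pick I ` {0..<card I} = I"
      using \<open>distinct _\<close> assms(1) pick_in_set_le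
      by (intro card_subset_eq) (auto simp: distinct_map card_image)
    then show "set (map (pick I) [0..<card I]) = set (sorted_list_of_set I)"
      using assms by simp
  qed auto
  then show ?thesis
    using assms(2) by (metis add_0 diff_zero length_upt nth_map nth_upt)
qed

lemma det_submatrix_eq_minor:
  assumes "I \<subseteq> {0..<dim_row A}" "J \<subseteq> {0..<dim_col A}" "card I = card J"
  shows "det (submatrix A I J) =
    minor (\<lambda>i j. A $$ (i, j)) (sorted_list_of_set I) (sorted_list_of_set J)"
proof -
  have fin: "finite I" "finite J"
    using assms finite_subset by blast+
  have "{i. i < dim_row A \<and> i \<in> I} = I" "{i. i < dim_col A \<and> i \<in> J} = J"
    using assms by auto
  then show ?thesis
    unfolding minor_def rows_det_def submatrix_def using assms(3) fin
    by (intro arg_cong[where f = det] eq_matI) (auto simp: pick_eq_nth_sorted_list_of_set)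
qed

lemma TP_iff_minors_pos:
  assumes "A \<in> carrier_mat n n"
  shows "TP r A \<longleftrightarrow> 1 \<le> r \<and> r \<le> n \<and> (\<forall>p. 1 \<le> p \<longrightarrow> p \<le> r \<longrightarrow> minors_pos n p (\<lambda>i j. A $$ (i, j)))"
    (is "_ \<longleftrightarrow> _ \<and> _ \<and> ?pos")
proof -
  have dims: "dim_row A = n" "dim_col A = n"
    using assms by auto
  have ?pos if TP: "TP r A"
    unfolding minors_pos_def
  proof (intro allI impI)
    fix p rs cs
    assume p: "1 \<le> p" "p \<le> r" and "sorted_wrt (<) rs" "sorted_wrt (<) cs"
      "set rs \<subseteq> {..<n}" "set cs \<subseteq> {..<n}" "length rs = p" "length cs = p"
    then have sets: "sorted_list_of_set (set rs) = rs" "sorted_list_of_set (set cs) = cs"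
      "card (set rs) = p" "card (set cs) = p" "set rs \<subseteq> {0..<n}" "set cs \<subseteq> {0..<n}"
      by (auto simp: strict_sorted_iff distinct_card sorted_list_of_set.idem_if_sorted_distinct)
    have "det (submatrix A (set rs) (set cs)) > 0"
      using TP p sets unfolding TP_def dims by metis
    then show "minor (\<lambda>i j. A $$ (i, j)) rs cs > 0"
      using det_submatrix_eq_minor[of "set rs" A "set cs"] sets by (simp add: dims)
  qed
  moreover have "det (submatrix A I J) > 0"
    if ?pos "I \<subseteq> {0..<n}" "J \<subseteq> {0..<n}" "card I = card J" "1 \<le> card I" "card I \<le> r" for I J
  proof -
    have "finite I" "finite J"
      using that finite_subset by blast+
    then have "minor (\<lambda>i j. A $$ (i, j)) (sorted_list_of_set I) (sorted_list_of_set J) > 0"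
      using that by (intro minors_posD[of n "card I"]) auto
    then show ?thesis
      using that det_submatrix_eq_minor[of I A J] by (simp add: dims)
  qed
  ultimately show ?thesis
    by (auto simp: TP_def dims)
qed

section \<open>Contiguous minors and Dodgson condensation\<close>

definition contiguous_minor :: "(nat \<Rightarrow> nat \<Rightarrow> real) \<Rightarrow> nat \<Rightarrow> nat \<Rightarrow> nat \<Rightarrow> real" where
  "contiguous_minor a m i j = minor a [i..<i + m] [j..<j + m]"

lemma contiguous_minor_eq_rows_det:
  "contiguous_minor a m i j = rows_det (map (\<lambda>r l. a r (j + l)) [i..<i + m])"
  unfolding contiguous_minor_def minor_def by (intro rows_det_cong) auto

lemma contiguous_minor_1 [simp]: "contiguous_minor a (Suc 0) i j = a i j"
  by (simp add: contiguous_minor_eq_rows_det rows_det_Cons)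

text \<open>The Desnanot-Jacobi identity for a block of contiguous rows and columns. In this
  division-free form it needs no nonvanishing minors, and \<open>m = 0\<close>, where the minor of
  order 0 is 1, gives the formula for \<open>2 \<times> 2\<close> minors.\<close>

lemma dodgson_condensation:
  "contiguous_minor a (m + 2) i j * contiguous_minor a m (i + 1) (j + 1) =
   contiguous_minor a (m + 1) i j * contiguous_minor a (m + 1) (i + 1) (j + 1) -
   contiguous_minor a (m + 1) i (j + 1) * contiguous_minor a (m + 1) (i + 1) j"
proof -
  have upt: "[i..<i + (m + 1)] = i # [Suc i..<Suc (i + m)]"
    "[i..<i + (m + 2)] = i # [Suc i..<Suc (i + m)] @ [Suc (i + m)]"
    "[Suc i..<Suc i + (m + 1)] = [Suc i..<Suc (i + m)] @ [Suc (i + m)]"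
    by (auto simp: upt_conv_Cons)
  show ?thesis
    using rows_det_desnanot_jacobi[of "\<lambda>l. a i (j + l)"
        "map (\<lambda>r l. a r (j + l)) [Suc i..<Suc (i + m)]" "\<lambda>l. a (Suc (i + m)) (j + l)"]
    unfolding contiguous_minor_eq_rows_det Suc_eq_plus1[symmetric, of i] upt
    by (simp add: comp_def del: upt_Suc)
qed

text \<open>Induction along the recursion of \<open>dodgson\<close>, dividing the condensation
  identity by its inner minor. The denominators met on the way are contiguous minors of orders below
  \<open>k\<close>, which is what \<open>nz\<close> covers.\<close>

lemma dodgson_eq_contiguous_minor:
  assumes A: "A \<in> carrier_mat n n"
    and nz: "\<And>m i j. 1 \<le> m \<Longrightarrow> m < k \<Longrightarrow> i + m \<le> n \<Longrightarrow> j + m \<le> n \<Longrightarrow>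
      contiguous_minor (\<lambda>i j. A $$ (i, j)) m i j \<noteq> 0"
  shows "dodgson k A \<in> carrier_mat (n - k) (n - k) \<and>
    (\<forall>i j. i + k < n \<longrightarrow> j + k < n \<longrightarrow>
      dodgson k A $$ (i, j) = contiguous_minor (\<lambda>i j. A $$ (i, j)) (Suc k) i j)"
  using A nz
proof (induction k A rule: dodgson.induct)
  case (1 A)
  then show ?case by simp
next
  case (2 A)
  then show ?case
    using dodgson_condensation[of "\<lambda>i j. A $$ (i, j)" 0]
    by (auto simp: contiguous_minor_eq_rows_det[of _ 0])
next
  case (3 k A)
  let ?c = "contiguous_minor (\<lambda>i j. A $$ (i, j))"
  have M: "dodgson (Suc k) A $$ (i, j) = ?c (k + 2) i j" if "i + Suc k < n" "j + Suc k < n" for i j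
    using 3 that by simp
  have N: "dodgson k A $$ (i, j) = ?c (k + 1) i j" if "i + k < n" "j + k < n" for i j
    using 3 that by simp
  have "dodgson (Suc (Suc k)) A $$ (i, j) = ?c (k + 3) i j"
    if ij: "i + (k + 2) < n" "j + (k + 2) < n" for i j
  proof -
    \<comment> \<open>This is the denominator, an entry of \<open>dodgson k A\<close>; its order
      \<open>k + 1\<close> lies below the bound \<open>Suc (Suc k)\<close> of this case.\<close>
    have "?c (k + 1) (i + 1) (j + 1) \<noteq> 0"
      using ij by (intro 3) auto
    then show ?thesis
      using ij 3(3) dodgson_condensation[of "\<lambda>i j. A $$ (i, j)" "k + 1" i j]
      by (auto simp: Let_def M N field_simps numeral_3_eq_3)
  qed
  then show ?case
    using 3(3) by (auto simp: Let_def numeral_3_eq_3)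
qed

theorem theorem4:
  fixes A :: "real mat" and n k :: nat
  assumes "A \<in> carrier_mat n n"
    and "1 \<le> k" and "k + 2 \<le> n"
    and "TP k A"
    and "TP 2 (dodgson k A)"
  shows "TP (k + 2) A"
proof -
  let ?a = "\<lambda>i j. A $$ (i, j)" and ?D = "dodgson k A"
  let ?d = "\<lambda>i j. ?D $$ (i, j)"
  have pos: "minors_pos n p ?a" if "1 \<le> p" "p \<le> k" for p
    using assms(4) that by (simp add: TP_iff_minors_pos[OF assms(1)])
  have lower: "contiguous_minor ?a m i j > 0" if "1 \<le> m" "m \<le> k" "i + m \<le> n" "j + m \<le> n" for m i j
    unfolding contiguous_minor_def using that by (intro minors_posD[OF pos]) auto
  have nz: "contiguous_minor ?a m i j \<noteq> 0"
    if "1 \<le> m" "m < k" "i + m \<le> n" "j + m \<le> n" for m i j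
    using lower[of m i j] that by simp
  have D: "?D \<in> carrier_mat (n - k) (n - k)"
    and d: "\<And>i j. i + k < n \<Longrightarrow> j + k < n \<Longrightarrow> ?d i j = contiguous_minor ?a (Suc k) i j"
    using dodgson_eq_contiguous_minor[OF assms(1) nz] by blast+
  have dpos: "minors_pos (n - k) p ?d" if "1 \<le> p" "p \<le> 2" for p
    using assms(5) that by (simp add: TP_iff_minors_pos[OF D])
  have d': "contiguous_minor ?d m i j > 0" if "1 \<le> m" "m \<le> 2" "i + m \<le> n - k" "j + m \<le> n - k" for m i j
    unfolding contiguous_minor_def using that by (intro minors_posD[OF dpos]) auto
  \<comment> \<open>The minors of order 1 of \<open>?D\<close> are its entries.\<close>
  have c1: "contiguous_minor ?a (Suc k) i j > 0" if "i + Suc k \<le> n" "j + Suc k \<le> n" for i j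
    using d'[of "Suc 0" i j] d that by simp
  have c2: "contiguous_minor ?a (Suc (Suc k)) i j > 0"
    if "i + Suc (Suc k) \<le> n" "j + Suc (Suc k) \<le> n" for i j
  proof -
    \<comment> \<open>Condensation is used with \<open>m = 0\<close> on \<open>?D\<close> and then
      with \<open>m = k\<close> on \<open>A\<close>. The factor of order \<open>k\<close> is
      positive by \<open>lower\<close>, so the sign passes to the minor of order
      \<open>k + 2\<close>.\<close>
    have "contiguous_minor ?d 2 i j = ?d i j * ?d (i + 1) (j + 1) - ?d i (j + 1) * ?d (i + 1) j"
      using dodgson_condensation[of ?d 0 i j]
      by (simp add: contiguous_minor_eq_rows_det[of _ 0] numeral_2_eq_2)
    also have "\<dots> = contiguous_minor ?a (k + 2) i j * contiguous_minor ?a k (i + 1) (j + 1)"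
      using that by (simp add: d dodgson_condensation[of ?a k i j, simplified])
    finally have "0 < contiguous_minor ?a (k + 2) i j * contiguous_minor ?a k (i + 1) (j + 1)"
      using d'[of 2 i j] that by simp
    moreover have "contiguous_minor ?a k (i + 1) (j + 1) > 0"
      using assms(2) that by (intro lower) auto
    ultimately show ?thesis
      by (simp add: zero_less_mult_iff)
  qed
  have p1: "minors_pos n (Suc k) ?a"
    using assms(2) pos c1 by (intro fekete) (auto simp: contiguous_minor_def simp del: upt_Suc)
  have p2: "minors_pos n (Suc (Suc k)) ?a"
    using p1 c2 by (intro fekete[of "Suc k"]) (auto simp: contiguous_minor_def simp del: upt_Suc)
  have "minors_pos n p ?a" if "1 \<le> p" "p \<le> k + 2" for p
    using that pos[of p] p1 p2 by (auto simp: le_Suc_eq)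
  then show ?thesis
    using assms(3) by (simp add: TP_iff_minors_pos[OF assms(1)])
qed

end
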